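(* Let $N,d,T\ge1$ be integers and suppose, without loss of generality, that $q_0^2=0\le q_1^2\le\dots\le q_T^2$ (with $q_t\ge0$) and $\sigma_0^2\ge\sigma_1^2\ge\dots\ge\sigma_T^2$; let $\boldsymbol q=(q_1,\dots,q_T)$ and $\boldsymbol\Gamma=(\sigma_0^2,\dots,\sigma_T^2)$. Let $\kappa=\frac1{4d}$ and $$\mathcal T_{\mathrm{w.o.}}=\Big\{t\in\{1,\dots,T\}:\ q_t^2\le\kappa\cdot\frac{d\sigma_0^2}{N}\Big\}.$$ Let $t_{\mathrm{w.o.}}$ be the weak-oracle index: $t_{\mathrm{w.o.}}=0$ if $\mathcal T_{\mathrm{w.o.}}=\emptyset$, and otherwise $t_{\mathrm{w.o.}}$ is the index of minimal $\sigma_t^2$ in $\mathcal T_{\mathrm{w.o.}}$, with largest $q_t$ among the minimizers (under the orderings above, the largest index in $\mathcal T_{\mathrm{w.o.}}$). Let $t_{\mathrm{med}}=\lceil (t_{\mathrm{w.o.}}+1)/2\rceil$ and $q_{\mathrm{med}}=q_{t_{\mathrm{med}}}$. Then $$L_{N,d}\big(\boldsymbol\Psi_{\le}(\boldsymbol q),\boldsymbol\Gamma\big)\ \ge\ \frac1{720}\cdot\Big(\frac{\sigma_T^2}{N}+q_{\mathrm{med}}^2\Big).$$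
   Context: Curriculum learning (CL) mean-estimation problem: for an instance $\boldsymbol\theta=(\theta_0,\theta_1,\dots,\theta_T)\in(\mathbb{R}^d)^{T+1}$ and noise variances $\sigma_t^2\in\mathbb{R}_+$, let $\{Z_{i,t}\}_{i\in\{1,\dots,N\},\,t\in\{0,\dots,T\}}$ be independent with $Z_{i,t}\sim\mathcal N(\theta_t,\sigma_t^2I_d)$. A CL algorithm $\mathcal A=(\pi,\hat\theta)$ adaptively chooses at step $i=1,\dots,N$ a model index $A_i\in\{0,\dots,T\}$ (possibly at random) according to a conditional distribution given only the history $(A_1,S_1,\dots,A_{i-1},S_{i-1})$, observes $S_i=Z_{i,A_i}$, and finally outputs an estimate $\hat\theta\in\mathbb{R}^d$ of $\theta_0$ that is a (possibly randomized) measurable function of $(A_i,S_i)_{i=1}^N$. The variances $\boldsymbol\Gamma$ are known to the algorithm. For $\boldsymbol\Psi\subseteq(\mathbb{R}^d)^{T+1}$ the minimax risk is $$L_{N,d}(\boldsymbol\Psi,\boldsymbol\Gamma):=\inf_{\mathcal A}\sup_{\boldsymbol\theta\in\boldsymbol\Psi}\mathbb{E}\big[\|\hat\theta-\theta_0\|^2\big].$$ The semi-local set is $$\boldsymbol\Psi_{\le}(\boldsymbol q):=\bigcup_{\zeta}\big\{\boldsymbol\theta\in(\mathbb{R}^d)^{T+1}:\ \|\theta_t-\theta_0\|^2\le q_{\zeta(t)}^2\ \text{for all }t\in\{1,\dots,T\}\big\},$$ the union being over all permutations $\zeta$ of $\{1,\dots,T\}$.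
   Formalization: When t_w.o. = 0 the stated bound is false (e.g. N = T = d = 1, σ_0 = σ_1 = 1, q_1 = 1000: risk at most 1); in that case only, q_med² is replaced by the threshold κ·dσ_0²/N = min(q_med², κ·dσ_0²/N). *)

theory Defs
  imports "HOL-Probability.Probability"
begin

section \<open>Gaussian observations\<close>

text \<open>
  The law \<open>N(\<mu>, v I)\<close>, realised as the image of independent standard normal
  coordinates under \<open>x \<mapsto> \<mu> + sqrt v x\<close>. This form also covers \<open>v = 0\<close>, where the
  law is the point mass at \<open>\<mu>\<close>.
\<close>

definition isotropic_gaussian :: "real ^ 'd \<Rightarrow> real \<Rightarrow> (real ^ 'd) measure" where
  "isotropic_gaussian \<mu> v =
     distr (\<Pi>\<^sub>M j\<in>(UNIV :: 'd set). density lborel std_normal_density) borel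
       (\<lambda>x. \<chi> j. \<mu> $ j + sqrt v * x j)"

text \<open>
  An instance is a function \<open>\<theta> :: nat \<Rightarrow> real ^ 'd\<close> of which only the values at
  \<open>0, \<dots>, T\<close> are ever used; likewise for the variances \<open>\<Gamma> t\<close> and the radii \<open>q t\<close>.
  The samples \<open>Z (i, t)\<close> are independent; steps are numbered \<open>0, \<dots>, N - 1\<close>.
\<close>

definition sample_table ::
  "nat \<Rightarrow> nat \<Rightarrow> (nat \<Rightarrow> real) \<Rightarrow> (nat \<Rightarrow> real ^ 'd) \<Rightarrow> (nat \<times> nat \<Rightarrow> real ^ 'd) measure" where
  "sample_table N T \<Gamma> \<theta> =
     (\<Pi>\<^sub>M (i, t)\<in>{..<N} \<times> {0..T}. isotropic_gaussian (\<theta> t) (\<Gamma> t))"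


section \<open>Curriculum learning algorithms\<close>

type_synonym 'd history = "nat \<Rightarrow> nat \<times> (real ^ 'd)"

text \<open>A history of length \<open>n\<close> records the pairs of chosen model and observed sample.\<close>

definition history_space :: "nat \<Rightarrow> nat \<Rightarrow> 'd::finite history measure" where
  "history_space T n = (\<Pi>\<^sub>M i\<in>{..<n}. count_space {0..T} \<Otimes>\<^sub>M borel)"

text \<open>
  The selection rule at step \<open>i\<close> and the estimator are Markov kernels, so both may
  randomise, but they see the samples only through the history.
\<close>

type_synonym 'd algorithm =
  "(nat \<Rightarrow> 'd history \<Rightarrow> nat measure) \<times> ('d history \<Rightarrow> (real ^ 'd) measure)"

definition cl_algorithms :: "nat \<Rightarrow> nat \<Rightarrow> 'd::finite algorithm set" where
  "cl_algorithms N T =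
     {(\<pi>, est).
        (\<forall>i<N. \<pi> i \<in> history_space T i \<rightarrow>\<^sub>M prob_algebra (count_space {0..T})) \<and>
        est \<in> history_space T N \<rightarrow>\<^sub>M prob_algebra borel}"

text \<open>The conditional law of the first \<open>n\<close> steps of the history, given the sample table \<open>z\<close>.\<close>

primrec history_law ::
  "nat \<Rightarrow> (nat \<Rightarrow> 'd::finite history \<Rightarrow> nat measure) \<Rightarrow> (nat \<times> nat \<Rightarrow> real ^ 'd) \<Rightarrow> nat \<Rightarrow>
    'd history measure" where
  "history_law T \<pi> z 0 = return (history_space T 0) (\<lambda>_. undefined)"
| "history_law T \<pi> z (Suc n) =
     history_law T \<pi> z n \<bind> (\<lambda>h. \<pi> n h \<bind> (\<lambda>a.
       return (history_space T (Suc n)) (h(n := (a, z (n, a))))))"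

definition estimate_law ::
  "nat \<Rightarrow> nat \<Rightarrow> (nat \<Rightarrow> real) \<Rightarrow> 'd::finite algorithm \<Rightarrow> (nat \<Rightarrow> real ^ 'd) \<Rightarrow> (real ^ 'd) measure" where
  "estimate_law N T \<Gamma> = (\<lambda>(\<pi>, est) \<theta>.
     sample_table N T \<Gamma> \<theta> \<bind> (\<lambda>z. history_law T \<pi> z N \<bind> est))"

definition risk ::
  "nat \<Rightarrow> nat \<Rightarrow> (nat \<Rightarrow> real) \<Rightarrow> 'd::finite algorithm \<Rightarrow> (nat \<Rightarrow> real ^ 'd) \<Rightarrow> ennreal" where
  "risk N T \<Gamma> alg \<theta> = (\<integral>\<^sup>+ x. ennreal ((norm (x - \<theta> 0))\<^sup>2) \<partial>estimate_law N T \<Gamma> alg \<theta>)"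

definition minimax_risk ::
  "nat \<Rightarrow> nat \<Rightarrow> (nat \<Rightarrow> real ^ 'd) set \<Rightarrow> (nat \<Rightarrow> real) \<Rightarrow> ennreal" where
  "minimax_risk N T \<Psi> \<Gamma> = (INF alg\<in>cl_algorithms N T. SUP \<theta>\<in>\<Psi>. risk N T \<Gamma> alg \<theta>)"


section \<open>The semi-local set and the weak oracle\<close>

definition semi_local :: "nat \<Rightarrow> (nat \<Rightarrow> real) \<Rightarrow> (nat \<Rightarrow> real ^ 'd) set" where
  "semi_local T q =
     (\<Union>\<zeta>\<in>{\<zeta>. \<zeta> permutes {1..T}}.
        {\<theta>. \<forall>t\<in>{1..T}. (norm (\<theta> t - \<theta> 0))\<^sup>2 \<le> (q (\<zeta> t))\<^sup>2})"

definition \<kappa> :: "nat \<Rightarrow> real" where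
  "\<kappa> d = 1 / (4 * real d)"

definition weak_oracle_set ::
  "nat \<Rightarrow> nat \<Rightarrow> nat \<Rightarrow> (nat \<Rightarrow> real) \<Rightarrow> (nat \<Rightarrow> real) \<Rightarrow> nat set" where
  "weak_oracle_set N d T q \<Gamma> = {t\<in>{1..T}. (q t)\<^sup>2 \<le> \<kappa> d * (real d * \<Gamma> 0 / real N)}"

text \<open>
  Minimal variance first, then largest radius; a remaining tie goes to the largest index.
\<close>

definition weak_oracle ::
  "nat \<Rightarrow> nat \<Rightarrow> nat \<Rightarrow> (nat \<Rightarrow> real) \<Rightarrow> (nat \<Rightarrow> real) \<Rightarrow> nat" where
  "weak_oracle N d T q \<Gamma> =
     (let W = weak_oracle_set N d T q \<Gamma>;
          M = {t\<in>W. \<forall>s\<in>W. \<Gamma> t \<le> \<Gamma> s}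
      in if W = {} then 0 else Max {t\<in>M. \<forall>s\<in>M. q s \<le> q t})"

text \<open>
  We have \<open>t_med t \<le> t\<close> for \<open>t \<ge> 1\<close>, but \<open>t_med 0 = 1\<close>. If the weak oracle is the target
  itself (index \<open>0\<close>), then \<open>(q 1)\<^sup>2\<close> exceeds the eligibility threshold
  \<open>\<kappa> d * (d * \<Gamma> 0 / N) = \<Gamma> 0 / (4 * N)\<close> and is otherwise unrestricted, whereas averaging
  \<open>N\<close> target samples already has risk \<open>d * \<Gamma> 0 / N\<close>. So in this case no positive multiple of
  \<open>(q (t_med 0))\<^sup>2\<close> can bound the minimax risk from below, and lower bounds use the
  truncation of \<open>(q 1)\<^sup>2\<close> at the threshold instead. For index \<open>t \<ge> 1\<close>, \<open>(q (t_med t))\<^sup>2\<close>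
  never exceeds the threshold.
\<close>

definition t_med :: "nat \<Rightarrow> nat" where
  "t_med t_wo = nat \<lceil>(real t_wo + 1) / 2\<rceil>"


section \<open>Well-formedness\<close>

lemma prob_space_isotropic_gaussian: "prob_space (isotropic_gaussian \<mu> v)"
proof -
  have "(\<lambda>x. \<chi> j. \<mu> $ j + sqrt v * x j)
      \<in> (\<Pi>\<^sub>M j\<in>UNIV. density lborel std_normal_density) \<rightarrow>\<^sub>M borel"
  proof (rule borel_measurable_euclidean_space[THEN iffD2, rule_format])
    fix b :: "real ^ 'a" assume "b \<in> Basis"
    then obtain i where "b = axis i 1" by (auto simp: Basis_vec_def)
    then show "(\<lambda>x. (\<chi> j. \<mu> $ j + sqrt v * x j) \<bullet> b)
        \<in> borel_measurable (\<Pi>\<^sub>M j\<in>UNIV. density lborel std_normal_density)"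
      by (simp add: inner_axis)
  qed
  then show ?thesis
    unfolding isotropic_gaussian_def
    by (intro prob_space.prob_space_distr prob_space_PiM prob_space_normal_density) auto
qed

lemma sets_isotropic_gaussian [measurable_cong, simp]:
  "sets (isotropic_gaussian \<mu> v) = sets borel"
  by (simp add: isotropic_gaussian_def)

lemma sets_sample_table:
  "sets (sample_table N T \<Gamma> \<theta>) = sets (\<Pi>\<^sub>M _\<in>{..<N} \<times> {0..T}. borel)"
  unfolding sample_table_def by (intro sets_PiM_cong) (auto split: prod.splits)

lemma prob_space_sample_table: "prob_space (sample_table N T \<Gamma> \<theta>)"
  unfolding sample_table_def
  by (intro prob_space_PiM) (auto simp: prob_space_isotropic_gaussian split: prod.splits)

text \<open>
  All kernels below are measurable, so that every bind in the definition of
  \<^const>\<open>estimate_law\<close> has its intended meaning.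
\<close>

lemma measurable_history_step:
  fixes n N T :: nat
  assumes "n < N"
  defines "Z \<equiv> (\<Pi>\<^sub>M _\<in>{..<N} \<times> {0..T}. borel :: (real ^ 'd) measure)"
  shows "(\<lambda>((z, h), a). h(n := (a, z (n, a))))
    \<in> (Z \<Otimes>\<^sub>M history_space T n) \<Otimes>\<^sub>M count_space {0..T} \<rightarrow>\<^sub>M history_space T (Suc n)"
proof -
  let ?M = "(Z \<Otimes>\<^sub>M history_space T n) \<Otimes>\<^sub>M count_space {0..T}"
  have "(\<lambda>w. fst (fst w) (n, a)) \<in> ?M \<rightarrow>\<^sub>M borel" if "a \<in> {0..T}" for a
    unfolding Z_def
    by (rule measurable_compose[OF measurable_compose[OF measurable_fst measurable_fst]
          measurable_component_singleton]) (use that assms in auto)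
  then have "(\<lambda>w. fst (fst w) (n, snd w)) \<in> ?M \<rightarrow>\<^sub>M borel"
    by (rule measurable_compose_countable'[where g = snd and I = "{0..T}", OF _ measurable_snd])
       (simp_all add: countable_finite)
  then have "(\<lambda>w. (snd w, fst (fst w) (n, snd w))) \<in> ?M \<rightarrow>\<^sub>M count_space {0..T} \<Otimes>\<^sub>M borel"
    by measurable
  moreover have "(\<lambda>w. snd (fst w)) \<in> ?M \<rightarrow>\<^sub>M history_space T n"
    by measurable
  ultimately have "(\<lambda>w. (snd (fst w))(n := (snd w, fst (fst w) (n, snd w))))
      \<in> ?M \<rightarrow>\<^sub>M history_space T (Suc n)"
    unfolding history_space_def by (intro measurable_fun_upd[where J = "{..<n}"]) auto
  then show ?thesis
    by (simp add: case_prod_beta')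
qed

lemma measurable_history_law:
  fixes \<pi> :: "nat \<Rightarrow> 'd::finite history \<Rightarrow> nat measure"
  assumes \<pi>: "\<And>i. i < N \<Longrightarrow> \<pi> i \<in> history_space T i \<rightarrow>\<^sub>M prob_algebra (count_space {0..T})"
    and "n \<le> N"
  shows "(\<lambda>z. history_law T \<pi> z n)
    \<in> (\<Pi>\<^sub>M _\<in>{..<N} \<times> {0..T}. borel) \<rightarrow>\<^sub>M prob_algebra (history_space T n)"
  using \<open>n \<le> N\<close>
proof (induction n)
  case 0
  have "(\<lambda>_. undefined) \<in> space (history_space T 0 :: 'd history measure)"
    by (simp add: history_space_def space_PiM)
  then show ?case
    by (auto simp: space_prob_algebra prob_space_return)
next
  case (Suc n)
  let ?Z = "\<Pi>\<^sub>M _\<in>{..<N} \<times> {0..T}. borel :: (real ^ 'd) measure"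
  have "(\<lambda>((z, h), a). return (history_space T (Suc n)) (h(n := (a, z (n, a)))))
      \<in> (?Z \<Otimes>\<^sub>M history_space T n) \<Otimes>\<^sub>M count_space {0..T} \<rightarrow>\<^sub>M prob_algebra (history_space T (Suc n))"
    using measurable_compose[OF measurable_history_step measurable_return_prob_space, of n N T] Suc.prems
    by (simp add: case_prod_beta')
  moreover have "(\<lambda>(z, h). \<pi> n h)
      \<in> ?Z \<Otimes>\<^sub>M history_space T n \<rightarrow>\<^sub>M prob_algebra (count_space {0..T})"
    unfolding case_prod_beta' using Suc.prems by (intro measurable_compose[OF measurable_snd \<pi>]) auto
  ultimately have "(\<lambda>(z, h). \<pi> n h \<bind> (\<lambda>a.
        return (history_space T (Suc n)) (h(n := (a, z (n, a))))))
      \<in> ?Z \<Otimes>\<^sub>M history_space T n \<rightarrow>\<^sub>M prob_algebra (history_space T (Suc n))"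
    unfolding case_prod_beta' by (intro measurable_bind_prob_space2) (auto simp: case_prod_beta')
  then show ?case
    using Suc by (auto intro!: measurable_bind_prob_space2)
qed

lemma estimate_law_prob_algebra:
  assumes "alg \<in> cl_algorithms N T"
  shows "estimate_law N T \<Gamma> alg \<theta> \<in> space (prob_algebra borel)"
proof -
  obtain \<pi> est where alg: "alg = (\<pi>, est)" by fastforce
  let ?Z = "\<Pi>\<^sub>M _\<in>{..<N} \<times> {0..T}. borel :: (real ^ 'a) measure"
  have \<pi>: "\<And>i. i < N \<Longrightarrow> \<pi> i \<in> history_space T i \<rightarrow>\<^sub>M prob_algebra (count_space {0..T})"
    and est: "est \<in> history_space T N \<rightarrow>\<^sub>M prob_algebra borel"
    using assms by (auto simp: cl_algorithms_def alg)
  have "(\<lambda>z. history_law T \<pi> z N \<bind> est) \<in> ?Z \<rightarrow>\<^sub>M prob_algebra borel"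
    using measurable_compose[OF measurable_snd est]
    by (intro measurable_bind_prob_space2[OF measurable_history_law[OF \<pi> order_refl]])
       (auto simp: case_prod_beta')
  then have "(\<lambda>_. sample_table N T \<Gamma> \<theta> \<bind> (\<lambda>z. history_law T \<pi> z N \<bind> est))
      \<in> count_space (UNIV :: unit set) \<rightarrow>\<^sub>M prob_algebra borel"
    by (intro measurable_bind_prob_space2[where N = ?Z])
       (auto simp: space_prob_algebra prob_space_sample_table sets_sample_table case_prod_beta'
             intro: measurable_compose[OF measurable_snd])
  then show ?thesis
    by (auto simp: estimate_law_def alg dest: measurable_space)
qed

text \<open>Under the orderings of the variances and radii, the weak oracle is the largest eligible index.\<close>

lemma weak_oracle_eq_Max:
  assumes q: "\<forall>t\<in>{1..T}. 0 \<le> q t" "mono_on {0..T} (\<lambda>t. (q t)\<^sup>2)" and \<Gamma>: "antimono_on {0..T} \<Gamma>"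
    and ne: "weak_oracle_set N d T q \<Gamma> \<noteq> {}"
  shows "weak_oracle N d T q \<Gamma> = Max (weak_oracle_set N d T q \<Gamma>)"
proof -
  define W where "W = weak_oracle_set N d T q \<Gamma>"
  define M where "M = {t\<in>W. \<forall>s\<in>W. \<Gamma> t \<le> \<Gamma> s}"
  have W: "W \<subseteq> {1..T}" "finite W" "W \<noteq> {}"
    using ne by (auto simp: W_def weak_oracle_set_def)
  then have m: "Max W \<in> W" "\<And>s. s \<in> W \<Longrightarrow> s \<le> Max W" by auto
  have "\<Gamma> (Max W) \<le> \<Gamma> s" if "s \<in> W" for s
    using m that W \<Gamma> by (intro monotone_onD[OF \<Gamma>]) auto
  moreover have "q s \<le> q (Max W)" if "s \<in> W" for s
  proof (rule power2_le_imp_le)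
    show "(q s)\<^sup>2 \<le> (q (Max W))\<^sup>2"
      using m that W by (intro monotone_onD[OF q(2)]) auto
    from m W have "Max W \<in> {1..T}" by blast
    with q show "0 \<le> q (Max W)" by blast
  qed
  ultimately have "Max {t\<in>M. \<forall>s\<in>M. q s \<le> q t} = Max W"
    using m W by (intro Max_eqI) (auto simp: M_def)
  with W show ?thesis
    by (simp add: weak_oracle_def Let_def W_def[symmetric] M_def[symmetric])
qed

end

theory Submission
  imports Defs
begin

text \<open>
  Two-point method with the inequality \<open>(\<integral> f dP)\<^sup>2 \<le> C \<integral> f\<^sup>2 dQ\<close>, that is, \<open>1 + \<chi>\<^sup>2(P, Q) \<le> C\<close>.
  In this form it needs no densities and its constants multiply along Markov kernels, so it
  follows an adaptive algorithm step by step: a step that queries a model whose mean moves by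
  \<open>\<delta>\<close> between the two instances costs a factor \<open>exp (\<delta>\<^sup>2 / \<sigma>\<^sub>t\<^sup>2)\<close>, any other step costs nothing.
  If \<open>\<delta>\<^sup>2 \<le> \<sigma>\<^sub>t\<^sup>2 / (4 N)\<close> for all models that move, then \<open>C = exp (1 / 4) \<le> 2\<close> after \<open>N\<close> steps and
  the risk at one of the two instances is at least \<open>\<delta>\<^sup>2 / 32\<close>. Moving all means together gives
  the term \<open>\<sigma>\<^sub>T\<^sup>2 / N\<close>. For \<open>q\<^sub>m\<^sub>e\<^sub>d\<close> only the target moves: the other models are split between
  \<open>0\<close> and \<open>q\<^sub>m\<^sub>e\<^sub>d\<close> so evenly that both \<open>\<theta>\<^sub>0 = 0\<close> and \<open>\<theta>\<^sub>0 = q\<^sub>m\<^sub>e\<^sub>d\<close> are admissible.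
\<close>

section \<open>Chi-square comparison of measures\<close>

lemma two_mult_le_power2_sum_ennreal: "2 * (a * b) \<le> a\<^sup>2 + b\<^sup>2" for a b :: ennreal
proof (cases "a = \<top> \<or> b = \<top>")
  case True
  then show ?thesis by (auto simp: power2_eq_square ennreal_top_mult)
next
  case False
  then obtain x y where "a = ennreal x" "b = ennreal y" "0 \<le> x" "0 \<le> y"
    by (metis ennreal_cases)
  moreover from this have "2 * (x * y) \<le> x\<^sup>2 + y\<^sup>2"
    using sum_squares_bound[of x y] by (simp add: mult.assoc)
  ultimately show ?thesis
    by (simp add: ennreal_power flip: ennreal_mult ennreal_plus ennreal_numeral)
qed

text \<open>Integrate \<open>2 (f x g y) (f y g x) \<le> (f x g y)\<^sup>2 + (f y g x)\<^sup>2\<close> over both variables.\<close>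

lemma Cauchy_Schwarz_nn_integral:
  assumes [measurable]: "f \<in> borel_measurable M" "g \<in> borel_measurable M"
  shows "(\<integral>\<^sup>+x. f x * g x \<partial>M)\<^sup>2 \<le> (\<integral>\<^sup>+x. (f x)\<^sup>2 \<partial>M) * (\<integral>\<^sup>+x. (g x)\<^sup>2 \<partial>M)"
proof -
  have "2 * (\<integral>\<^sup>+x. f x * g x \<partial>M)\<^sup>2 = (\<integral>\<^sup>+x. \<integral>\<^sup>+y. 2 * ((f x * g x) * (f y * g y)) \<partial>M \<partial>M)"
    by (simp add: nn_integral_cmult nn_integral_multc power2_eq_square)
  also have "\<dots> \<le> (\<integral>\<^sup>+x. \<integral>\<^sup>+y. (f x)\<^sup>2 * (g y)\<^sup>2 + (g x)\<^sup>2 * (f y)\<^sup>2 \<partial>M \<partial>M)"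
  proof (intro nn_integral_mono)
    fix x y
    show "2 * ((f x * g x) * (f y * g y)) \<le> (f x)\<^sup>2 * (g y)\<^sup>2 + (g x)\<^sup>2 * (f y)\<^sup>2"
      using two_mult_le_power2_sum_ennreal[of "f x * g y" "g x * f y"]
      by (simp add: power_mult_distrib mult_ac)
  qed
  also have "\<dots> = 2 * ((\<integral>\<^sup>+x. (f x)\<^sup>2 \<partial>M) * (\<integral>\<^sup>+x. (g x)\<^sup>2 \<partial>M))"
    by (simp add: nn_integral_add nn_integral_cmult nn_integral_multc mult_2 mult.commute)
  \<comment> \<open>Cancelling the factor 2 is legitimate in \<open>ennreal\<close> because 2 is
    neither 0 nor infinite.\<close>
  finally show ?thesis
    by (subst (asm) ennreal_mult_le_mult_iff) auto
qed

lemma (in prob_space) nn_integral_power2_le: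
  assumes [measurable]: "f \<in> borel_measurable M"
  shows "(\<integral>\<^sup>+x. f x \<partial>M)\<^sup>2 \<le> (\<integral>\<^sup>+x. (f x)\<^sup>2 \<partial>M)"
  using Cauchy_Schwarz_nn_integral[of f M "\<lambda>_. 1"] by (simp add: emeasure_space_1)

text \<open>For finite \<open>C\<close> this forces absolute continuity, by testing with indicators
  of \<open>Q\<close>-null sets. Testing with truncations of the density of \<open>P\<close> then
  bounds the second moment of that density under \<open>Q\<close>, which is one plus the chi-square
  divergence.\<close>

definition chi2_le :: "'a measure \<Rightarrow> 'a measure \<Rightarrow> ennreal \<Rightarrow> bool" where
  "chi2_le P Q C \<longleftrightarrow> (\<forall>f\<in>borel_measurable Q. (\<integral>\<^sup>+x. f x \<partial>P)\<^sup>2 \<le> C * (\<integral>\<^sup>+x. (f x)\<^sup>2 \<partial>Q))"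

lemma chi2_leD:
  "chi2_le P Q C \<Longrightarrow> f \<in> borel_measurable Q \<Longrightarrow> (\<integral>\<^sup>+x. f x \<partial>P)\<^sup>2 \<le> C * (\<integral>\<^sup>+x. (f x)\<^sup>2 \<partial>Q)"
  by (simp add: chi2_le_def)

lemma chi2_le_mono: "chi2_le P Q C \<Longrightarrow> C \<le> D \<Longrightarrow> chi2_le P Q D"
  unfolding chi2_le_def by (meson mult_right_mono order_trans zero_le)

lemma chi2_le_refl:
  assumes "prob_space P"
  shows "chi2_le P P 1"
  using prob_space.nn_integral_power2_le[OF assms] by (simp add: chi2_le_def)

text \<open>Apply the bound for \<open>P\<close> and \<open>Q\<close> to the inner integral of
  \<open>f\<close> against \<open>K x\<close>, then the bound for the kernels under the outer
  integral over \<open>Q\<close>. The two constants therefore multiply.\<close>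

lemma chi2_le_bind:
  assumes PQ: "chi2_le P Q C" and sets: "sets P = sets M" "sets Q = sets M"
    and K: "K \<in> M \<rightarrow>\<^sub>M subprob_algebra N" and L: "L \<in> M \<rightarrow>\<^sub>M subprob_algebra N"
    and KL: "\<And>x. x \<in> space M \<Longrightarrow> chi2_le (K x) (L x) D"
  shows "chi2_le (P \<bind> K) (Q \<bind> L) (C * D)"
  unfolding chi2_le_def
proof
  fix f :: "'b \<Rightarrow> ennreal" assume f: "f \<in> borel_measurable (Q \<bind> L)"
  have sp: "space Q = space M"
    using sets by (auto dest: sets_eq_imp_space_eq)
  note cong' = measurable_cong_sets[OF sets(1) refl] measurable_cong_sets[OF sets(2) refl]
  show "(\<integral>\<^sup>+x. f x \<partial>(P \<bind> K))\<^sup>2 \<le> C * D * (\<integral>\<^sup>+x. (f x)\<^sup>2 \<partial>(Q \<bind> L))"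
  \<comment> \<open>On an empty space \<open>bind\<close> takes its default value, an empty measure,
    and the left-hand side is 0.\<close>
  proof (cases "space M = {}")
    case True
    with sets have "space P = {}" by (auto dest: sets_eq_imp_space_eq)
    then show ?thesis by (simp add: bind_empty nn_integral_empty)
  next
    case False
    have "sets (Q \<bind> L) = sets N"
      using L False by (intro sets_bind[where N=N]) (auto simp: sp cong' dest: sets_kernel)
    with f have f[measurable]: "f \<in> borel_measurable N" by (simp cong: measurable_cong_sets)
    have "(\<integral>\<^sup>+x. f x \<partial>(P \<bind> K))\<^sup>2 = (\<integral>\<^sup>+x. \<integral>\<^sup>+y. f y \<partial>K x \<partial>P)\<^sup>2"
      using K by (subst nn_integral_bind[where B=N]) (auto simp: cong')
    also have "\<dots> \<le> C * (\<integral>\<^sup>+x. (\<integral>\<^sup>+y. f y \<partial>K x)\<^sup>2 \<partial>Q)"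
      using K by (intro chi2_leD[OF PQ])
        (auto simp: sets cong: measurable_cong_sets intro!: nn_integral_measurable_subprob_algebra2[where N=N])
    also have "\<dots> \<le> C * (\<integral>\<^sup>+x. D * (\<integral>\<^sup>+y. (f y)\<^sup>2 \<partial>L x) \<partial>Q)"
    proof (intro mult_left_mono nn_integral_mono)
      fix x assume x: "x \<in> space Q"
      then have "sets (L x) = sets N" using L by (auto simp: sp dest: sets_kernel)
      then show "(\<integral>\<^sup>+y. f y \<partial>K x)\<^sup>2 \<le> D * (\<integral>\<^sup>+y. (f y)\<^sup>2 \<partial>L x)"
        using x by (intro chi2_leD[OF KL]) (auto simp: sp cong: measurable_cong_sets)
    qed simp
    also have "\<dots> = C * D * (\<integral>\<^sup>+x. \<integral>\<^sup>+y. (f y)\<^sup>2 \<partial>L x \<partial>Q)"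
      using L by (subst nn_integral_cmult)
        (auto simp: sets mult.assoc cong: measurable_cong_sets intro!: nn_integral_measurable_subprob_algebra2[where N=N])
    also have "\<dots> = C * D * (\<integral>\<^sup>+x. (f x)\<^sup>2 \<partial>(Q \<bind> L))"
      using L by (subst nn_integral_bind[where B=N]) (auto simp: cong')
    finally show ?thesis .
  qed
qed

lemma chi2_le_distr:
  assumes PQ: "chi2_le P Q C" and "sets P = sets Q" and g[measurable]: "g \<in> Q \<rightarrow>\<^sub>M N"
  shows "chi2_le (distr P N g) (distr Q N g) C"
  unfolding chi2_le_def
proof
  fix f :: "'b \<Rightarrow> ennreal" assume [measurable]: "f \<in> borel_measurable (distr Q N g)"
  then have [measurable]: "f \<in> borel_measurable N" by simp
  have [measurable]: "g \<in> P \<rightarrow>\<^sub>M N" using g assms(2) by (simp cong: measurable_cong_sets)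
  show "(\<integral>\<^sup>+x. f x \<partial>distr P N g)\<^sup>2 \<le> C * (\<integral>\<^sup>+x. (f x)\<^sup>2 \<partial>distr Q N g)"
    using chi2_leD[OF PQ, of "\<lambda>x. f (g x)"] by (simp add: nn_integral_distr)
qed

section \<open>Shifted Gaussians\<close>

lemma prob_space_std_normal: "prob_space std_normal_distribution"
  by (rule prob_space_normal_density) simp

lemma std_normal_density_shift:
  "std_normal_density (y + a) = std_normal_density y * exp (- a * y - a\<^sup>2 / 2)"
  by (simp add: std_normal_density_def flip: exp_add) (simp add: field_simps power2_eq_square)

text \<open>Translation by \<open>a\<close> under Lebesgue measure; the exponential weight is the
  likelihood ratio from the density identity above.\<close>

lemma nn_integral_std_normal_shift:
  assumes [measurable]: "f \<in> borel_measurable borel"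
  shows "(\<integral>\<^sup>+y. f y \<partial>std_normal_distribution) = (\<integral>\<^sup>+y. ennreal (exp (- a * y - a\<^sup>2 / 2)) * f (y + a) \<partial>std_normal_distribution)"
proof -
  have "(\<integral>\<^sup>+y. f y \<partial>std_normal_distribution) = (\<integral>\<^sup>+y. ennreal (std_normal_density y) * f y \<partial>lborel)"
    by (simp add: nn_integral_density)
  also have "\<dots> = (\<integral>\<^sup>+y. ennreal (std_normal_density (y + a)) * f (y + a) \<partial>lborel)"
    using nn_integral_real_affine[of "\<lambda>y. ennreal (std_normal_density y) * f y" 1 a] by (simp add: add.commute)
  also have "\<dots> = (\<integral>\<^sup>+y. ennreal (exp (- a * y - a\<^sup>2 / 2)) * f (y + a) \<partial>std_normal_distribution)"
    by (simp add: nn_integral_density std_normal_density_shift ennreal_mult mult.assoc)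
  finally show ?thesis .
qed

text \<open>The second moment of the likelihood ratio, found without evaluating a Gaussian integral:
  the ratio for the shift \<open>2 * a\<close> integrates to 1, and its exponent differs from the
  present one by the constant \<open>a\<^sup>2\<close>.\<close>

lemma nn_integral_std_normal_exp: "(\<integral>\<^sup>+y. ennreal (exp (- 2 * a * y - a\<^sup>2)) \<partial>std_normal_distribution) = ennreal (exp (a\<^sup>2))"
proof -
  have "1 = (\<integral>\<^sup>+y. 1 \<partial>std_normal_distribution)"
    using prob_space.emeasure_space_1[OF prob_space_std_normal] by simp
  also have "\<dots> = (\<integral>\<^sup>+y. ennreal (exp (- (2 * a) * y - (2 * a)\<^sup>2 / 2)) \<partial>std_normal_distribution)"
    by (subst nn_integral_std_normal_shift[of _ "2 * a"]) simp_all
  finally have 1: "1 = (\<integral>\<^sup>+y. ennreal (exp (- (2 * a) * y - (2 * a)\<^sup>2 / 2)) \<partial>std_normal_distribution)" .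
  have "ennreal (exp (a\<^sup>2)) = (\<integral>\<^sup>+y. ennreal (exp (a\<^sup>2)) * ennreal (exp (- (2 * a) * y - (2 * a)\<^sup>2 / 2)) \<partial>std_normal_distribution)"
    by (subst nn_integral_cmult) (simp, simp only: 1[symmetric] mult_1_right)
  also have "\<dots> = (\<integral>\<^sup>+y. ennreal (exp (- 2 * a * y - a\<^sup>2)) \<partial>std_normal_distribution)"
    by (intro nn_integral_cong) (simp add: power2_eq_square flip: ennreal_mult exp_add)
  finally show ?thesis ..
qed

text \<open>Cauchy-Schwarz separates the likelihood ratio from the shifted function. Since
  \<open>y + a\<close> has law N(a, 1), this is the chi-square comparison of N(0, 1) with N(a,
  1).\<close>

lemma std_normal_shift_bound:
  assumes [measurable]: "f \<in> borel_measurable borel"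
  shows "(\<integral>\<^sup>+y. f y \<partial>std_normal_distribution)\<^sup>2 \<le> ennreal (exp (a\<^sup>2)) * (\<integral>\<^sup>+y. (f (y + a))\<^sup>2 \<partial>std_normal_distribution)"
proof -
  have "(\<integral>\<^sup>+y. f y \<partial>std_normal_distribution)\<^sup>2 \<le>
      (\<integral>\<^sup>+y. (ennreal (exp (- a * y - a\<^sup>2 / 2)))\<^sup>2 \<partial>std_normal_distribution) * (\<integral>\<^sup>+y. (f (y + a))\<^sup>2 \<partial>std_normal_distribution)"
    by (subst nn_integral_std_normal_shift[of _ a]) (auto intro!: Cauchy_Schwarz_nn_integral)
  also have "(\<integral>\<^sup>+y. (ennreal (exp (- a * y - a\<^sup>2 / 2)))\<^sup>2 \<partial>std_normal_distribution) = ennreal (exp (a\<^sup>2))"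
    by (subst nn_integral_std_normal_exp[symmetric], intro nn_integral_cong)
      (simp add: ennreal_power algebra_simps flip: exp_double)
  finally show ?thesis .
qed

lemma measurable_isotropic_gaussian_map:
  "(\<lambda>x. \<chi> j. \<mu> $ j + c * x j) \<in> (\<Pi>\<^sub>M j\<in>(UNIV :: 'd::finite set). std_normal_distribution) \<rightarrow>\<^sub>M borel"
proof (rule borel_measurable_euclidean_space[THEN iffD2, rule_format])
  fix b :: "real ^ 'd" assume "b \<in> Basis"
  then obtain i where "b = axis i 1" by (auto simp: Basis_vec_def)
  then show "(\<lambda>x. (\<chi> j. \<mu> $ j + c * x j) \<bullet> b) \<in> borel_measurable (\<Pi>\<^sub>M j\<in>UNIV. std_normal_distribution)"
    by (simp add: inner_axis)
qed

text \<open>Only coordinate \<open>k\<close> separates the two laws. It is integrated innermost,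
  where the one-dimensional bound applies; the remaining coordinates have a common law, so Jensen's
  inequality moves the square inside at no cost.\<close>

lemma chi2_le_isotropic_gaussian_axis:
  fixes \<mu> :: "real ^ 'd"
  assumes v: "0 < v"
  shows "chi2_le (isotropic_gaussian \<mu> v) (isotropic_gaussian (\<mu> + axis k \<delta>) v) (ennreal (exp (\<delta>\<^sup>2 / v)))"
  unfolding chi2_le_def
proof
  let ?S = "\<lambda>_::'d. std_normal_distribution"
  interpret product_sigma_finite ?S
    by (intro product_sigma_finite.intro prob_space_imp_sigma_finite prob_space_std_normal)
  interpret R: prob_space "PiM (- {k}) ?S"
    by (intro prob_space_PiM prob_space_std_normal)
  define G where "G = (\<lambda>(\<mu> :: real ^ 'd) x. \<chi> j. \<mu> $ j + sqrt v * x j)"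
  have G[measurable]: "G \<mu> \<in> PiM UNIV ?S \<rightarrow>\<^sub>M borel" for \<mu>
    unfolding G_def by (rule measurable_isotropic_gaussian_map)
  \<comment> \<open>The displacement in units of the standard deviation, so that
    \<open>a\<^sup>2\<close> is the exponent \<open>\<delta>\<^sup>2 / v\<close>.\<close>
  define a where "a = \<delta> / sqrt v"
  have shift: "G (\<mu> + axis k \<delta>) (x(k := y)) = G \<mu> (x(k := y + a))" for x y
    using v by (auto simp: G_def vec_eq_iff axis_def a_def algebra_simps)
  have UNIV: "insert k (- {k}) = UNIV"
    by auto
  have fold: "(\<integral>\<^sup>+x. g x \<partial>PiM UNIV ?S) = (\<integral>\<^sup>+x. \<integral>\<^sup>+y. g (x(k := y)) \<partial>std_normal_distribution \<partial>PiM (- {k}) ?S)"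
    if "g \<in> borel_measurable (PiM UNIV ?S)" for g
    using product_nn_integral_insert[of "- {k}" k g] that by (simp add: UNIV)
  fix f :: "real ^ 'd \<Rightarrow> ennreal" assume "f \<in> borel_measurable (isotropic_gaussian (\<mu> + axis k \<delta>) v)"
  then have f[measurable]: "f \<in> borel_measurable borel" by (simp cong: measurable_cong_sets)
  have upd[measurable]: "(\<lambda>(x, y). x(k := y)) \<in> PiM (- {k}) ?S \<Otimes>\<^sub>M std_normal_distribution \<rightarrow>\<^sub>M PiM UNIV ?S"
    using measurable_add_dim[of k "- {k}" ?S] by (simp add: UNIV)
  have upd'[measurable]: "(\<lambda>y. x(k := y)) \<in> borel \<rightarrow>\<^sub>M PiM UNIV ?S" if "x \<in> space (PiM (- {k}) ?S)" for x
    using measurable_compose[OF measurable_Pair1'[OF that, of std_normal_distribution] upd] by simp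
  have gm[measurable]: "(\<lambda>(x, y). f (G \<mu> (x(k := y)))) \<in> borel_measurable (PiM (- {k}) ?S \<Otimes>\<^sub>M std_normal_distribution)"
    using measurable_compose[OF measurable_compose[OF upd G] f] by (simp add: case_prod_beta')
  have "(\<integral>\<^sup>+x. f x \<partial>isotropic_gaussian \<mu> v)\<^sup>2 = (\<integral>\<^sup>+x. f (G \<mu> x) \<partial>PiM UNIV ?S)\<^sup>2"
    unfolding isotropic_gaussian_def using G by (simp add: nn_integral_distr G_def)
  also have "\<dots> = (\<integral>\<^sup>+x. \<integral>\<^sup>+y. f (G \<mu> (x(k := y))) \<partial>std_normal_distribution \<partial>PiM (- {k}) ?S)\<^sup>2"
    by (subst fold) simp_all
  also have "\<dots> \<le> (\<integral>\<^sup>+x. (\<integral>\<^sup>+y. f (G \<mu> (x(k := y))) \<partial>std_normal_distribution)\<^sup>2 \<partial>PiM (- {k}) ?S)"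
    by (rule R.nn_integral_power2_le) simp
  also have "\<dots> \<le> (\<integral>\<^sup>+x. ennreal (exp (a\<^sup>2)) * (\<integral>\<^sup>+y. (f (G \<mu> (x(k := y + a))))\<^sup>2 \<partial>std_normal_distribution) \<partial>PiM (- {k}) ?S)"
    by (intro nn_integral_mono std_normal_shift_bound measurable_compose[OF measurable_compose[OF upd' G] f])
  also have "\<dots> = (\<integral>\<^sup>+x. ennreal (exp (a\<^sup>2)) * (\<integral>\<^sup>+y. (f (G (\<mu> + axis k \<delta>) (x(k := y))))\<^sup>2 \<partial>std_normal_distribution) \<partial>PiM (- {k}) ?S)"
    by (simp add: shift)
  also have "\<dots> = ennreal (exp (a\<^sup>2)) * (\<integral>\<^sup>+x. \<integral>\<^sup>+y. (f (G (\<mu> + axis k \<delta>) (x(k := y))))\<^sup>2 \<partial>std_normal_distribution \<partial>PiM (- {k}) ?S)"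
    using measurable_compose[OF measurable_compose[OF upd G] f, of "\<mu> + axis k \<delta>"]
    by (intro nn_integral_cmult sigma_finite_measure.borel_measurable_nn_integral)
      (auto simp: case_prod_beta' prob_space_imp_sigma_finite prob_space_std_normal)
  also have "\<dots> = ennreal (exp (a\<^sup>2)) * (\<integral>\<^sup>+x. (f (G (\<mu> + axis k \<delta>) x))\<^sup>2 \<partial>PiM UNIV ?S)"
    by (subst fold) simp_all
  also have "\<dots> = ennreal (exp (a\<^sup>2)) * (\<integral>\<^sup>+x. (f x)\<^sup>2 \<partial>isotropic_gaussian (\<mu> + axis k \<delta>) v)"
    unfolding isotropic_gaussian_def using G[of "\<mu> + axis k \<delta>"] by (simp add: nn_integral_distr G_def)
  finally show "(\<integral>\<^sup>+x. f x \<partial>isotropic_gaussian \<mu> v)\<^sup>2 \<le>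
      ennreal (exp (\<delta>\<^sup>2 / v)) * (\<integral>\<^sup>+x. (f x)\<^sup>2 \<partial>isotropic_gaussian (\<mu> + axis k \<delta>) v)"
    using v by (simp add: a_def power_divide)
qed

section \<open>The law of the history\<close>

text \<open>Fubini for kernels, with measurability stated over reference spaces \<open>A\<close> and
  \<open>B\<close> that share only their measurable sets with the measures integrated.\<close>

lemma bind_commute:
  assumes P: "prob_space P" "sets P = sets A" and Q: "prob_space Q" "sets Q = sets B"
    and C: "(\<lambda>(x, y). C x y) \<in> A \<Otimes>\<^sub>M B \<rightarrow>\<^sub>M subprob_algebra R"
  shows "P \<bind> (\<lambda>x. Q \<bind> C x) = Q \<bind> (\<lambda>y. P \<bind> (\<lambda>x. C x y))"
proof -
  interpret A: prob_space P by fact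
  interpret B: prob_space Q by fact
  interpret pair_prob_space P Q ..
  have "(\<lambda>(x, y). C x y) \<in> P \<Otimes>\<^sub>M Q \<rightarrow>\<^sub>M subprob_algebra R"
    using C P(2) Q(2) by (simp cong: measurable_cong_sets sets_pair_measure_cong)
  then show ?thesis
    by (rule bind_rotate)
qed

text \<open>The product measure is itself a nested bind of point masses; associativity and the unit
  law do the rest.\<close>

lemma bind_pair_measure:
  assumes "prob_space P" "prob_space Q"
    and C[measurable]: "(\<lambda>(x, y). C x y) \<in> P \<Otimes>\<^sub>M Q \<rightarrow>\<^sub>M subprob_algebra R"
  shows "(P \<Otimes>\<^sub>M Q) \<bind> (\<lambda>(x, y). C x y) = P \<bind> (\<lambda>x. Q \<bind> C x)"
proof -
  interpret A: prob_space P by fact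
  interpret B: prob_space Q by fact
  interpret pair_prob_space P Q ..
  note measurable_bind[where N=Q, measurable]
  have [simp]: "Q \<in> space (subprob_algebra Q)"
    by (auto simp: space_subprob_algebra) unfold_locales
  have "(P \<Otimes>\<^sub>M Q) \<bind> (\<lambda>(x, y). C x y) =
      (P \<bind> (\<lambda>x. Q \<bind> (\<lambda>y. return (P \<Otimes>\<^sub>M Q) (x, y)))) \<bind> (\<lambda>(x, y). C x y)"
    by (simp flip: pair_measure_eq_bind)
  also have "\<dots> = P \<bind> (\<lambda>x. Q \<bind> C x)"
    by (auto intro!: bind_cong simp: bind_return[where N=R] space_pair_measure bind_assoc[where N="P \<Otimes>\<^sub>M Q" and R=R])
  finally show ?thesis .
qed

section \<open>Mixing two independent copies of a product measure\<close>

lemma measurable_PiM_mix: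
  "(\<lambda>(x, y) i. if i \<in> J then x i else y i) \<in> PiM I M \<Otimes>\<^sub>M PiM I M \<rightarrow>\<^sub>M PiM I M"
  by (rule measurable_PiM_single')
    (auto simp: space_pair_measure space_PiM PiE_iff extensional_def case_prod_beta'
      intro!: measurable_compose[OF measurable_fst] measurable_compose[OF measurable_snd])

text \<open>The preimage of a box is a product of two boxes, one constraining the coordinates in
  \<open>J\<close> of the first copy and one the other coordinates of the second. Their masses
  multiply to the mass of the original box, and boxes determine the product measure.\<close>

lemma distr_PiM_mix:
  assumes fin: "finite I" and M: "\<And>i. prob_space (M i)"
  shows "distr (PiM I M \<Otimes>\<^sub>M PiM I M) (PiM I M) (\<lambda>(x, y) i. if i \<in> J then x i else y i) = PiM I M"
    (is "distr _ _ ?m = _")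
proof -
  interpret product_sigma_finite M
    by (intro product_sigma_finite.intro prob_space_imp_sigma_finite M)
  interpret M: prob_space "M i" for i by (rule M)
  interpret I: prob_space "PiM I M" by (intro prob_space_PiM M)
  note [measurable] = measurable_PiM_mix
  show ?thesis
  proof (rule PiM_eqI[OF fin])
    fix A assume A: "\<And>i. i \<in> I \<Longrightarrow> A i \<in> sets (M i)"
    define B where "B = (\<lambda>i. if i \<in> J then A i else space (M i))"
    define C where "C = (\<lambda>i. if i \<in> J then space (M i) else A i)"
    have AS: "\<And>i. i \<in> I \<Longrightarrow> A i \<subseteq> space (M i)" using A sets.sets_into_space by blast
    have [measurable]: "Pi\<^sub>E I A \<in> sets (PiM I M)" "Pi\<^sub>E I B \<in> sets (PiM I M)" "Pi\<^sub>E I C \<in> sets (PiM I M)"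
      using A fin by (auto intro!: sets_PiM_I_finite simp: B_def C_def)
    have "?m -` Pi\<^sub>E I A \<inter> space (PiM I M \<Otimes>\<^sub>M PiM I M) = Pi\<^sub>E I B \<times> Pi\<^sub>E I C"
      using AS by (fastforce simp: space_pair_measure space_PiM PiE_iff extensional_def B_def C_def split: if_splits)
    then have "emeasure (distr (PiM I M \<Otimes>\<^sub>M PiM I M) (PiM I M) ?m) (Pi\<^sub>E I A) =
        emeasure (PiM I M) (Pi\<^sub>E I B) * emeasure (PiM I M) (Pi\<^sub>E I C)"
      by (simp add: emeasure_distr I.emeasure_pair_measure_Times)
    also have "\<dots> = (\<Prod>i\<in>I. emeasure (M i) (B i) * emeasure (M i) (C i))"
      using A fin by (simp add: emeasure_PiM B_def C_def prod.distrib)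
    also have "\<dots> = (\<Prod>i\<in>I. emeasure (M i) (A i))"
      by (intro prod.cong) (auto simp: B_def C_def M.emeasure_space_1)
    finally show "emeasure (distr (PiM I M \<Otimes>\<^sub>M PiM I M) (PiM I M) ?m) (Pi\<^sub>E I A) = (\<Prod>i\<in>I. emeasure (M i) (A i))" .
  qed simp
qed

lemma history_law_cong:
  assumes "\<And>i a. i < n \<Longrightarrow> z (i, a) = z' (i, a)"
  shows "history_law T \<pi> z n = history_law T \<pi> z' n"
  using assms
proof (induction n)
  case (Suc n)
  from Suc.prems have "history_law T \<pi> z n = history_law T \<pi> z' n" by (intro Suc.IH) simp
  moreover from Suc.prems have "z (n, a) = z' (n, a)" for a by simp
  ultimately show ?case by simp
qed simp

section \<open>The history as a Markov chain\<close>

abbreviation table_space :: "nat \<Rightarrow> nat \<Rightarrow> (nat \<times> nat \<Rightarrow> real ^ 'd) measure" where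
  "table_space N T \<equiv> \<Pi>\<^sub>M _\<in>{..<N} \<times> {0..T}. borel"

text \<open>The transition in which the queried sample is drawn afresh instead of being read from a
  table fixed in advance. As a kernel on histories it can be compared between instances one step at
  a time.\<close>

definition step_law ::
  "nat \<Rightarrow> (nat \<Rightarrow> real) \<Rightarrow> (nat \<Rightarrow> 'd::finite history \<Rightarrow> nat measure) \<Rightarrow> (nat \<Rightarrow> real ^ 'd) \<Rightarrow> nat \<Rightarrow>
    'd history \<Rightarrow> 'd history measure" where
  "step_law T \<Gamma> \<pi> \<theta> n h = \<pi> n h \<bind> (\<lambda>a.
     distr (isotropic_gaussian (\<theta> a) (\<Gamma> a)) (history_space T (Suc n)) (\<lambda>s. h(n := (a, s))))"

definition marginal_law ::
  "nat \<Rightarrow> nat \<Rightarrow> (nat \<Rightarrow> real) \<Rightarrow> (nat \<Rightarrow> 'd::finite history \<Rightarrow> nat measure) \<Rightarrow> (nat \<Rightarrow> real ^ 'd) \<Rightarrow> nat \<Rightarrow>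
    'd history measure" where
  "marginal_law N T \<Gamma> \<pi> \<theta> n = sample_table N T \<Gamma> \<theta> \<bind> (\<lambda>z. history_law T \<pi> z n)"

lemma measurable_history_upd:
  "(\<lambda>(h, a, s). h(n := (a, s))) \<in>
    history_space T n \<Otimes>\<^sub>M (count_space {0..T} \<Otimes>\<^sub>M borel) \<rightarrow>\<^sub>M history_space T (Suc n)"
  unfolding history_space_def case_prod_beta'
  by (intro measurable_fun_upd[where J = "{..<n}"]) auto

lemma distr_sample_table_component:
  assumes "n < N" "a \<le> T"
  shows "distr (sample_table N T \<Gamma> \<theta>) borel (\<lambda>z. z (n, a)) = isotropic_gaussian (\<theta> a) (\<Gamma> a)"
proof -
  let ?M = "\<lambda>(i, t). isotropic_gaussian (\<theta> t) (\<Gamma> t)"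
  have "distr (sample_table N T \<Gamma> \<theta>) borel (\<lambda>z. z (n, a)) = distr (PiM ({..<N} \<times> {0..T}) ?M) (?M (n, a)) (\<lambda>z. z (n, a))"
    unfolding sample_table_def by (intro distr_cong) auto
  also have "\<dots> = ?M (n, a)"
    using assms by (intro distr_PiM_component) (auto simp: prob_space_isotropic_gaussian)
  finally show ?thesis by simp
qed

text \<open>
  The rows \<open>< n\<close> of the table determine the first \<open>n\<close> steps, so replacing the other rows by
  those of an independent copy leaves the law unchanged and makes the next sample independent
  of the history.
\<close>

lemma sample_table_bind_decouple:
  assumes F: "F \<in> table_space N T \<rightarrow>\<^sub>M subprob_algebra R"
  shows "sample_table N T \<Gamma> \<theta> \<bind> F =
    sample_table N T \<Gamma> \<theta> \<bind> (\<lambda>z. sample_table N T \<Gamma> \<theta> \<bind> (\<lambda>y. F (\<lambda>p. if fst p < n then z p else y p)))"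
proof -
  let ?S = "sample_table N T \<Gamma> \<theta>"
  let ?M = "\<lambda>(i :: nat, t). isotropic_gaussian (\<theta> t) (\<Gamma> t)"
  let ?m = "\<lambda>(z, y) p. if p \<in> {p. fst p < n} then z p else (y p :: real ^ 'a)"
  interpret S: prob_space ?S by (rule prob_space_sample_table)
  interpret SS: pair_prob_space ?S ?S ..
  have F': "F \<in> ?S \<rightarrow>\<^sub>M subprob_algebra R"
    using F by (simp add: sets_sample_table cong: measurable_cong_sets)
  have S: "distr (?S \<Otimes>\<^sub>M ?S) ?S ?m = ?S"
    unfolding sample_table_def
    by (rule distr_PiM_mix) (simp_all add: prob_space_isotropic_gaussian split: prod.split)
  have m: "?m \<in> ?S \<Otimes>\<^sub>M ?S \<rightarrow>\<^sub>M ?S"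
    unfolding sample_table_def
    by (rule measurable_PiM_mix)
  have eq: "(\<lambda>x. F (?m x)) = (\<lambda>(z, y). F (?m (z, y)))"
    by (intro ext) auto
  have "?S \<bind> F = distr (?S \<Otimes>\<^sub>M ?S) ?S ?m \<bind> F" by (simp only: S)
  also have "\<dots> = (?S \<Otimes>\<^sub>M ?S) \<bind> (\<lambda>x. F (?m x))"
    by (rule bind_distr[OF m F' SS.P.not_empty])
  also have "\<dots> = (?S \<Otimes>\<^sub>M ?S) \<bind> (\<lambda>(z, y). F (?m (z, y)))"
    by (simp only: eq)
  also have "\<dots> = ?S \<bind> (\<lambda>z. ?S \<bind> (\<lambda>y. F (?m (z, y))))"
    using measurable_compose[OF m F', unfolded eq] by (intro bind_pair_measure S.prob_space_axioms)
  finally show ?thesis by simp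
qed

lemma measurable_distr_history_upd:
  fixes \<theta> :: "nat \<Rightarrow> real ^ 'd"
  shows "(\<lambda>(h, a). distr (isotropic_gaussian (\<theta> a) (\<Gamma> a)) (history_space T (Suc n)) (\<lambda>s. h(n := (a, s))))
    \<in> history_space T n \<Otimes>\<^sub>M count_space {0..T} \<rightarrow>\<^sub>M prob_algebra (history_space T (Suc n))"
proof -
  have "(\<lambda>x. isotropic_gaussian (\<theta> (snd x)) (\<Gamma> (snd x))) \<in> history_space T n \<Otimes>\<^sub>M count_space {0..T} \<rightarrow>\<^sub>M prob_algebra borel"
    by (rule measurable_compose[OF measurable_snd]) (simp add: space_prob_algebra prob_space_isotropic_gaussian)
  moreover have "(\<lambda>(x, s). (fst x)(n := (snd x, s))) \<in>
      (history_space T n \<Otimes>\<^sub>M count_space {0..T}) \<Otimes>\<^sub>M borel \<rightarrow>\<^sub>M history_space T (Suc n)"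
    using measurable_compose[OF _ measurable_history_upd, of "\<lambda>x. (fst (fst x), snd (fst x), snd x)"
        "(history_space T n \<Otimes>\<^sub>M count_space {0..T}) \<Otimes>\<^sub>M borel" T n]
    by (simp add: case_prod_beta')
  ultimately show ?thesis
    unfolding case_prod_beta' by (intro measurable_distr_prob_space2[where M=borel]) (auto simp: case_prod_beta')
qed

context
  fixes N T :: nat and \<Gamma> :: "nat \<Rightarrow> real" and \<pi> :: "nat \<Rightarrow> 'd::finite history \<Rightarrow> nat measure"
  assumes \<pi>: "\<And>i. i < N \<Longrightarrow> \<pi> i \<in> history_space T i \<rightarrow>\<^sub>M prob_algebra (count_space {0..T})"
begin

lemma measurable_step_law:
  assumes "n < N"
  shows "step_law T \<Gamma> \<pi> \<theta> n \<in> history_space T n \<rightarrow>\<^sub>M prob_algebra (history_space T (Suc n))"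
  unfolding step_law_def[abs_def]
  by (rule measurable_bind_prob_space2[OF \<pi>[OF assms] measurable_distr_history_upd])

text \<open>For a fixed history, exchange the table with the choice of model: once \<open>a\<close>
  is fixed, only the entry \<open>(n, a)\<close> is read, and its marginal is the Gaussian of model
  \<open>a\<close>.\<close>

lemma sample_table_bind_step:
  assumes n: "n < N" and h: "h \<in> space (history_space T n)"
  shows "sample_table N T \<Gamma> \<theta> \<bind> (\<lambda>y. \<pi> n h \<bind> (\<lambda>a. return (history_space T (Suc n)) (h(n := (a, y (n, a)))))) =
    step_law T \<Gamma> \<pi> \<theta> n h"
proof -
  let ?S = "sample_table N T \<Gamma> \<theta>" and ?H = "history_space T (Suc n)"
  interpret S: prob_space ?S by (rule prob_space_sample_table)
  have \<pi>h: "prob_space (\<pi> n h)" "sets (\<pi> n h) = sets (count_space {0..T})"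
    using measurable_space[OF \<pi>[OF n] h] by (auto simp: space_prob_algebra)
  have "(\<lambda>(y, a). ((y, h), a)) \<in>
      table_space N T \<Otimes>\<^sub>M count_space {0..T} \<rightarrow>\<^sub>M (table_space N T \<Otimes>\<^sub>M history_space T n) \<Otimes>\<^sub>M count_space {0..T}"
    using h by simp
  from measurable_compose[OF this measurable_history_step[OF n]]
  have upd: "(\<lambda>(y, a). h(n := (a, y (n, a)))) \<in> table_space N T \<Otimes>\<^sub>M count_space {0..T} \<rightarrow>\<^sub>M ?H"
    by (simp add: case_prod_beta')
  have "?S \<bind> (\<lambda>y. \<pi> n h \<bind> (\<lambda>a. return ?H (h(n := (a, y (n, a)))))) =
      \<pi> n h \<bind> (\<lambda>a. ?S \<bind> (\<lambda>y. return ?H (h(n := (a, y (n, a))))))"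
    using measurable_compose[OF upd return_measurable]
    by (intro bind_commute[where A="table_space N T" and B="count_space {0..T}"] \<pi>h S.prob_space_axioms)
      (simp_all add: sets_sample_table case_prod_beta')
  also have "\<dots> = step_law T \<Gamma> \<pi> \<theta> n h"
    unfolding step_law_def
  proof (intro bind_cong refl)
    fix a assume "a \<in> space (\<pi> n h)"
    then have a: "a \<le> T" using sets_eq_imp_space_eq[OF \<pi>h(2)] by simp
    have y: "(\<lambda>y. y (n, a)) \<in> ?S \<rightarrow>\<^sub>M borel"
      using a n by (auto simp: sets_sample_table cong: measurable_cong_sets)
    have s: "(\<lambda>s. h(n := (a, s))) \<in> borel \<rightarrow>\<^sub>M ?H"
      using measurable_compose[OF _ measurable_history_upd, of "\<lambda>s. (h, a, s)"] a h by simp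
    have "?S \<bind> (\<lambda>y. return ?H (h(n := (a, y (n, a))))) = distr ?S ?H (\<lambda>y. h(n := (a, y (n, a))))"
      using measurable_compose[OF y s] by (intro bind_return_distr' S.not_empty)
    also have "\<dots> = distr (distr ?S borel (\<lambda>y. y (n, a))) ?H (\<lambda>s. h(n := (a, s)))"
      using y s by (simp add: distr_distr comp_def)
    finally show "?S \<bind> (\<lambda>y. return ?H (h(n := (a, y (n, a))))) =
        distr (isotropic_gaussian (\<theta> a) (\<Gamma> a)) ?H (\<lambda>s. h(n := (a, s)))"
      using a n by (simp add: distr_sample_table_component)
  qed
  finally show ?thesis .
qed

text \<open>After decoupling, the history of length \<open>n\<close> depends on one table
  \<open>z\<close> and the next sample on an independent table \<open>y\<close>. Integrating over
  \<open>y\<close> for a fixed history leaves the fresh-sample kernel.\<close>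

lemma marginal_law_Suc:
  assumes n: "n < N"
  shows "marginal_law N T \<Gamma> \<pi> \<theta> (Suc n) = marginal_law N T \<Gamma> \<pi> \<theta> n \<bind> step_law T \<Gamma> \<pi> \<theta> n"
proof -
  let ?S = "sample_table N T \<Gamma> \<theta>" and ?H = "history_space T (Suc n)" and ?Z = "table_space N T"
  define R where "R = (\<lambda>y h. \<pi> n h \<bind> (\<lambda>a. return ?H (h(n := (a, y (n, a))))))"
  interpret S: prob_space ?S by (rule prob_space_sample_table)
  have hl: "(\<lambda>z. history_law T \<pi> z m) \<in> ?Z \<rightarrow>\<^sub>M prob_algebra (history_space T m)" if "m \<le> N" for m
    using \<pi> that by (rule measurable_history_law)
  have "(\<lambda>x. \<pi> n (snd x)) \<in> ?Z \<Otimes>\<^sub>M history_space T n \<rightarrow>\<^sub>M prob_algebra (count_space {0..T})"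
    by (rule measurable_compose[OF measurable_snd \<pi>[OF n]])
  then have R: "(\<lambda>(y, h). R y h) \<in> ?Z \<Otimes>\<^sub>M history_space T n \<rightarrow>\<^sub>M prob_algebra ?H"
    using measurable_compose[OF measurable_history_step[OF n] measurable_return_prob_space]
    unfolding R_def case_prod_beta' by (intro measurable_bind_prob_space2) (auto simp: case_prod_beta')
  \<comment> \<open>The first \<open>n\<close> steps see only rows below \<open>n\<close>, all taken
    from \<open>z\<close>; row \<open>n\<close>, read by \<open>R\<close>, comes from
    \<open>y\<close>.\<close>
  have mix: "history_law T \<pi> (\<lambda>p. if fst p < n then z p else y p) n = history_law T \<pi> z n" for z y
    by (rule history_law_cong) simp
  have "marginal_law N T \<Gamma> \<pi> \<theta> (Suc n) = ?S \<bind> (\<lambda>z. ?S \<bind> (\<lambda>y. history_law T \<pi> z n \<bind> R y))"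
    unfolding marginal_law_def
    using n mix by (subst sample_table_bind_decouple[where n=n, OF measurable_prob_algebraD[OF hl]]) (simp_all add: R_def)
  also have "\<dots> = ?S \<bind> (\<lambda>z. history_law T \<pi> z n \<bind> step_law T \<Gamma> \<pi> \<theta> n)"
  proof (intro bind_cong refl)
    fix z assume "z \<in> space ?S"
    then have "history_law T \<pi> z n \<in> space (prob_algebra (history_space T n))"
      using n sets_eq_imp_space_eq[OF sets_sample_table, of N T \<Gamma> \<theta>] by (intro measurable_space[OF hl]) auto
    then have z: "prob_space (history_law T \<pi> z n)" "sets (history_law T \<pi> z n) = sets (history_space T n)"
      by (auto simp: space_prob_algebra)
    \<comment> \<open>Exchange the history with the fresh table, so that the history is held fixed
      while \<open>y\<close> is averaged out.\<close>
    have "?S \<bind> (\<lambda>y. history_law T \<pi> z n \<bind> R y) = history_law T \<pi> z n \<bind> (\<lambda>h. ?S \<bind> (\<lambda>y. R y h))"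
      using R by (intro bind_commute[where A="?Z" and B="history_space T n"] z S.prob_space_axioms sets_sample_table)
        (rule measurable_prob_algebraD)
    also have "\<dots> = history_law T \<pi> z n \<bind> step_law T \<Gamma> \<pi> \<theta> n"
      using n by (intro bind_cong refl)
        (auto simp: R_def sample_table_bind_step dest: sets_eq_imp_space_eq[OF z(2), THEN equalityD1, THEN subsetD])
    finally show "?S \<bind> (\<lambda>y. history_law T \<pi> z n \<bind> R y) = history_law T \<pi> z n \<bind> step_law T \<Gamma> \<pi> \<theta> n" .
  qed
  also have "\<dots> = marginal_law N T \<Gamma> \<pi> \<theta> n \<bind> step_law T \<Gamma> \<pi> \<theta> n"
    unfolding marginal_law_def
    using n measurable_prob_algebraD[OF hl, of n] measurable_prob_algebraD[OF measurable_step_law[OF n]]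
    by (intro bind_assoc[symmetric, where N="history_space T n" and R="?H"])
      (auto simp: sets_sample_table cong: measurable_cong_sets)
  finally show ?thesis .
qed

end

section \<open>Comparison of two instances along the algorithm\<close>

lemma marginal_law_prob_algebra:
  assumes \<pi>: "\<And>i. i < N \<Longrightarrow> \<pi> i \<in> history_space T i \<rightarrow>\<^sub>M prob_algebra (count_space {0..T})" and n: "n \<le> N"
  shows "marginal_law N T \<Gamma> \<pi> \<theta> n \<in> space (prob_algebra (history_space T n))"
proof -
  have "(\<lambda>_. marginal_law N T \<Gamma> \<pi> \<theta> n) \<in> count_space (UNIV :: unit set) \<rightarrow>\<^sub>M prob_algebra (history_space T n)"
    unfolding marginal_law_def
    by (rule measurable_bind_prob_space[OF _ measurable_history_law[OF \<pi> n]])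
      (auto simp: space_prob_algebra prob_space_sample_table sets_sample_table)
  then show ?thesis
    by (auto dest: measurable_space)
qed

lemma estimate_law_eq_marginal:
  assumes \<pi>: "\<And>i. i < N \<Longrightarrow> \<pi> i \<in> history_space T i \<rightarrow>\<^sub>M prob_algebra (count_space {0..T})"
    and est: "est \<in> history_space T N \<rightarrow>\<^sub>M prob_algebra borel"
  shows "estimate_law N T \<Gamma> (\<pi>, est) \<theta> = marginal_law N T \<Gamma> \<pi> \<theta> N \<bind> est"
proof -
  have "(\<lambda>z. history_law T \<pi> z N) \<in> table_space N T \<rightarrow>\<^sub>M prob_algebra (history_space T N)"
    by (rule measurable_history_law[OF \<pi> order_refl])
  then have "(\<lambda>z. history_law T \<pi> z N) \<in> sample_table N T \<Gamma> \<theta> \<rightarrow>\<^sub>M subprob_algebra (history_space T N)"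
    by (simp add: measurable_prob_algebraD sets_sample_table cong: measurable_cong_sets)
  then show ?thesis
    unfolding estimate_law_def marginal_law_def prod.case
    by (rule bind_assoc[symmetric, OF _ measurable_prob_algebraD[OF est]])
qed

text \<open>An adaptive algorithm may query the most informative model at every step, so the factor
  \<open>exp \<epsilon>\<close> has to cover each model separately. Induction then multiplies one
  such factor per step.\<close>

lemma chi2_le_marginal_law:
  fixes \<theta> \<theta>' :: "nat \<Rightarrow> real ^ 'd"
  assumes \<pi>: "\<And>i. i < N \<Longrightarrow> \<pi> i \<in> history_space T i \<rightarrow>\<^sub>M prob_algebra (count_space {0..T})"
    and \<theta>: "\<And>t. t \<le> T \<Longrightarrow> \<theta>' t = \<theta> t \<or> \<theta>' t = \<theta> t + axis k \<delta> \<and> 0 < \<Gamma> t \<and> \<delta>\<^sup>2 \<le> \<epsilon> * \<Gamma> t"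
    and \<epsilon>: "0 \<le> \<epsilon>" and n: "n \<le> N"
  shows "chi2_le (marginal_law N T \<Gamma> \<pi> \<theta> n) (marginal_law N T \<Gamma> \<pi> \<theta>' n) (ennreal (exp \<epsilon>) ^ n)"
  using n
proof (induction n)
  case 0
  let ?R = "return (history_space T 0) (\<lambda>_. undefined) :: 'd history measure"
  have R: "prob_space ?R"
    by (rule prob_space_return) (simp add: history_space_def space_PiM)
  \<comment> \<open>No step has been taken: the law is the point mass at the empty history, whatever
    the instance.\<close>
  then have "marginal_law N T \<Gamma> \<pi> \<theta> 0 = ?R" for \<theta>
    by (simp add: marginal_law_def bind_const' prob_space_sample_table prob_space_imp_subprob_space)
  with chi2_le_refl[OF R] show ?case by simp
next
  case (Suc n)
  then have n: "n < N" by simp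
  have gauss: "chi2_le (isotropic_gaussian (\<theta> a) (\<Gamma> a)) (isotropic_gaussian (\<theta>' a) (\<Gamma> a)) (ennreal (exp \<epsilon>))"
    if "a \<le> T" for a
    using \<theta>[OF that]
  proof
    assume "\<theta>' a = \<theta> a"
    with \<epsilon> show ?thesis
      by (auto intro!: chi2_le_mono[OF chi2_le_refl] simp: prob_space_isotropic_gaussian)
  next
    assume a: "\<theta>' a = \<theta> a + axis k \<delta> \<and> 0 < \<Gamma> a \<and> \<delta>\<^sup>2 \<le> \<epsilon> * \<Gamma> a"
    then have "ennreal (exp (\<delta>\<^sup>2 / \<Gamma> a)) \<le> ennreal (exp \<epsilon>)"
      by (simp add: divide_le_eq)
    with a show ?thesis
      by (auto intro: chi2_le_mono[OF chi2_le_isotropic_gaussian_axis])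
  qed
  have step: "chi2_le (step_law T \<Gamma> \<pi> \<theta> n h) (step_law T \<Gamma> \<pi> \<theta>' n h) (ennreal (exp \<epsilon>))"
    if h: "h \<in> space (history_space T n)" for h
  proof -
    have \<pi>h: "prob_space (\<pi> n h)" "sets (\<pi> n h) = sets (count_space {0..T})"
      using measurable_space[OF \<pi>[OF n] h] by (auto simp: space_prob_algebra)
    have m: "(\<lambda>a. distr (isotropic_gaussian (\<theta> a) (\<Gamma> a)) (history_space T (Suc n)) (\<lambda>s. h(n := (a, s))))
        \<in> count_space {0..T} \<rightarrow>\<^sub>M subprob_algebra (history_space T (Suc n))" for \<theta> :: "nat \<Rightarrow> real ^ 'd"
      using measurable_compose[OF measurable_Pair1'[OF h] measurable_prob_algebraD[OF measurable_distr_history_upd, of \<theta> \<Gamma>]]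
      by (simp only: prod.case)
    \<comment> \<open>The selection rule is the same kernel under both instances and contributes the
      factor 1; only the sample law changes.\<close>
    have "chi2_le (step_law T \<Gamma> \<pi> \<theta> n h) (step_law T \<Gamma> \<pi> \<theta>' n h) (1 * ennreal (exp \<epsilon>))"
      unfolding step_law_def
    proof (rule chi2_le_bind[OF chi2_le_refl[OF \<pi>h(1)] \<pi>h(2) \<pi>h(2) m m])
      fix a assume "a \<in> space (count_space {0..T})"
      then show "chi2_le (distr (isotropic_gaussian (\<theta> a) (\<Gamma> a)) (history_space T (Suc n)) (\<lambda>s. h(n := (a, s))))
          (distr (isotropic_gaussian (\<theta>' a) (\<Gamma> a)) (history_space T (Suc n)) (\<lambda>s. h(n := (a, s)))) (ennreal (exp \<epsilon>))"
        using measurable_compose[OF _ measurable_history_upd, of "\<lambda>s. (h, a, s)" borel] h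
        by (intro chi2_le_distr gauss) (auto cong: measurable_cong_sets)
    qed
    then show ?thesis by simp
  qed
  have sets: "sets (marginal_law N T \<Gamma> \<pi> \<theta> n) = sets (history_space T n)" for \<theta>
    using marginal_law_prob_algebra[of N \<pi> T n \<Gamma> \<theta>, OF \<pi>] n by (auto simp: space_prob_algebra)
  have "chi2_le (marginal_law N T \<Gamma> \<pi> \<theta> n \<bind> step_law T \<Gamma> \<pi> \<theta> n)
      (marginal_law N T \<Gamma> \<pi> \<theta>' n \<bind> step_law T \<Gamma> \<pi> \<theta>' n) (ennreal (exp \<epsilon>) ^ n * ennreal (exp \<epsilon>))"
    using n by (intro chi2_le_bind[where M="history_space T n" and N="history_space T (Suc n)"] Suc.IH sets step
        measurable_prob_algebraD[OF measurable_step_law[OF \<pi>]]) auto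
  then show ?case
    using marginal_law_Suc[OF \<pi> n] by (simp add: mult.commute)
qed

section \<open>Two-point lower bounds\<close>

text \<open>
  The test \<open>B\<close> decides for \<open>a\<close>; either it fails under \<open>P\<close> with probability at least \<open>1/2\<close>,
  or \<open>P B > 1/2\<close> and then \<open>(P B)\<^sup>2 \<le> 2 Q B\<close> makes it fail under \<open>Q\<close> with probability at least \<open>1/8\<close>.
\<close>

lemma two_point_bound:
  fixes a b :: "'a :: {real_normed_vector, second_countable_topology}"
  assumes P: "prob_space P" "sets P = sets borel" and Q: "prob_space Q" "sets Q = sets borel"
    and PQ: "chi2_le P Q 2"
  shows "ennreal ((norm (b - a))\<^sup>2 / 32) \<le>
    max (\<integral>\<^sup>+x. ennreal ((norm (x - a))\<^sup>2) \<partial>P) (\<integral>\<^sup>+x. ennreal ((norm (x - b))\<^sup>2) \<partial>Q)"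
proof -
  interpret P: prob_space P by fact
  interpret Q: prob_space Q by fact
  define D where "D = norm (b - a)"
  have D: "0 \<le> D" by (simp add: D_def)
  define B where "B = {x. norm (x - a) < D / 2}"
  have B: "B \<in> sets borel" unfolding B_def by measurable
  have space: "space P = UNIV" "space Q = UNIV"
    using P(2) Q(2) by (auto dest: sets_eq_imp_space_eq)
  note [measurable_cong] = P(2) Q(2)
  note [measurable] = B
  \<comment> \<open>An output outside \<open>B\<close> is at least \<open>D / 2\<close> from
    \<open>a\<close>, and by the triangle inequality one inside \<open>B\<close> is at least
    \<open>D / 2\<close> from \<open>b\<close>. Each error costs \<open>D\<^sup>2 / 4\<close>, and
    probability \<open>1 / 8\<close> of an error gives \<open>D\<^sup>2 / 32\<close>.\<close>
  have far_a: "ennreal (D\<^sup>2 / 4) * indicator (- B) x \<le> ennreal ((norm (x - a))\<^sup>2)" for x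
    using power_mono[of "D / 2" "norm (x - a)" 2] D
    by (auto simp: B_def power_divide split: split_indicator)
  have far_b: "ennreal (D\<^sup>2 / 4) * indicator B x \<le> ennreal ((norm (x - b))\<^sup>2)" for x
  proof -
    have "D / 2 \<le> norm (x - b)" if "x \<in> B"
      using that norm_triangle_ineq[of "b - x" "x - a"] by (simp add: B_def D_def norm_minus_commute)
    then show ?thesis
      using power_mono[of "D / 2" "norm (x - b)" 2] D
      by (auto simp: power_divide split: split_indicator)
  qed
  have "ennreal (D\<^sup>2 / 4) * emeasure P (- B) = (\<integral>\<^sup>+x. ennreal (D\<^sup>2 / 4) * indicator (- B) x \<partial>P)"
    by (rule nn_integral_cmult_indicator[symmetric]) measurable
  also have "\<dots> \<le> (\<integral>\<^sup>+x. ennreal ((norm (x - a))\<^sup>2) \<partial>P)"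
    by (intro nn_integral_mono far_a)
  finally have Pa: "ennreal (D\<^sup>2 / 4 * (1 - P.prob B)) \<le> (\<integral>\<^sup>+x. ennreal ((norm (x - a))\<^sup>2) \<partial>P)"
    using P.prob_compl[of B] by (simp add: P.emeasure_eq_measure space Compl_eq_Diff_UNIV flip: ennreal_mult)
  have "ennreal (D\<^sup>2 / 4) * emeasure Q B = (\<integral>\<^sup>+x. ennreal (D\<^sup>2 / 4) * indicator B x \<partial>Q)"
    by (rule nn_integral_cmult_indicator[symmetric]) measurable
  also have "\<dots> \<le> (\<integral>\<^sup>+x. ennreal ((norm (x - b))\<^sup>2) \<partial>Q)"
    by (intro nn_integral_mono far_b)
  finally have Qb: "ennreal (D\<^sup>2 / 4 * Q.prob B) \<le> (\<integral>\<^sup>+x. ennreal ((norm (x - b))\<^sup>2) \<partial>Q)"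
    by (simp add: Q.emeasure_eq_measure flip: ennreal_mult)
  have sq: "(indicator B x :: ennreal)\<^sup>2 = indicator B x" for x
    by (simp split: split_indicator)
  \<comment> \<open>The indicator of \<open>B\<close> as test function; it equals its own
    square.\<close>
  have "(emeasure P B)\<^sup>2 \<le> 2 * emeasure Q B"
    using chi2_leD[OF PQ, of "indicator B"] by (simp add: sq)
  then have chi: "(P.prob B)\<^sup>2 \<le> 2 * Q.prob B"
    by (simp add: P.emeasure_eq_measure Q.emeasure_eq_measure ennreal_power flip: ennreal_mult ennreal_numeral)
  show ?thesis
  proof (cases "P.prob B \<le> 1 / 2")
    case True
    then have "D\<^sup>2 / 32 \<le> D\<^sup>2 / 4 * (1 - P.prob B)"
      using mult_left_mono[of "1 / 8" "1 - P.prob B" "D\<^sup>2 / 4"] by simp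
    from order_trans[OF ennreal_leI[OF this] Pa] show ?thesis
      by (simp add: le_max_iff_disj flip: D_def)
  next
    case False
    then have "1 / 8 \<le> Q.prob B"
      using power_mono[of "1 / 2" "P.prob B" 2] chi by (simp add: power_divide)
    then have "D\<^sup>2 / 32 \<le> D\<^sup>2 / 4 * Q.prob B"
      using mult_left_mono[of "1 / 8" "Q.prob B" "D\<^sup>2 / 4"] by simp
    from order_trans[OF ennreal_leI[OF this] Qb] show ?thesis
      by (simp add: le_max_iff_disj flip: D_def)
  qed
qed

lemma norm_axis: "norm (axis k x :: real ^ 'n) = \<bar>x\<bar>"
proof -
  have "axis k x = x *\<^sub>R (axis k 1 :: real ^ 'n)"
    by (simp add: vec_eq_iff axis_def)
  then show ?thesis by simp
qed

text \<open>For every algorithm the two output laws are within the factor 2 demanded by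
  \<open>two_point_bound\<close>, and the supremum over \<open>\<Psi>\<close> dominates the worse of
  the two risks.\<close>

lemma minimax_risk_two_point:
  fixes \<theta> \<theta>' :: "nat \<Rightarrow> real ^ 'd"
  assumes N: "1 \<le> N" and \<Psi>: "\<theta> \<in> \<Psi>" "\<theta>' \<in> \<Psi>" and \<theta>0: "\<theta>' 0 = \<theta> 0 + axis k \<delta>"
    and \<theta>: "\<And>t. t \<le> T \<Longrightarrow> \<theta>' t = \<theta> t \<or> \<theta>' t = \<theta> t + axis k \<delta> \<and> \<delta>\<^sup>2 \<le> \<Gamma> t / (4 * real N)"
  shows "ennreal (\<delta>\<^sup>2 / 32) \<le> minimax_risk N T \<Psi> \<Gamma>"
  unfolding minimax_risk_def
proof (rule INF_greatest)
  fix alg :: "'d algorithm" assume alg_in: "alg \<in> cl_algorithms N T"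
  obtain \<pi> est where alg: "alg = (\<pi>, est)" by fastforce
  have \<pi>: "\<And>i. i < N \<Longrightarrow> \<pi> i \<in> history_space T i \<rightarrow>\<^sub>M prob_algebra (count_space {0..T})"
    and est: "est \<in> history_space T N \<rightarrow>\<^sub>M prob_algebra borel"
    using alg_in by (auto simp: cl_algorithms_def alg)
  let ?P = "estimate_law N T \<Gamma> alg"
  have P: "prob_space (?P \<theta>)" "sets (?P \<theta>) = sets borel" for \<theta>
    using estimate_law_prob_algebra[OF alg_in] by (auto simp: space_prob_algebra)
  have law: "?P \<theta> = marginal_law N T \<Gamma> \<pi> \<theta> N \<bind> est" for \<theta>
    unfolding alg using \<pi> est by (rule estimate_law_eq_marginal)
  have est_prob: "prob_space (est h)" if "h \<in> space (history_space T N)" for h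
    using measurable_space[OF est that] by (simp add: space_prob_algebra)
  have sets: "sets (marginal_law N T \<Gamma> \<pi> \<theta> N) = sets (history_space T N)" for \<theta>
    using marginal_law_prob_algebra[of N \<pi> T N \<Gamma> \<theta>, OF \<pi>] by (auto simp: space_prob_algebra)
  \<comment> \<open>The Gaussian comparison needs positive variance. If \<open>\<delta> = 0\<close>
    nothing moves; otherwise the bound on \<open>\<delta>\<^sup>2\<close> forces it.\<close>
  have "\<theta>' t = \<theta> t \<or> \<theta>' t = \<theta> t + axis k \<delta> \<and> 0 < \<Gamma> t \<and> \<delta>\<^sup>2 \<le> 1 / (4 * real N) * \<Gamma> t" if "t \<le> T" for t
  proof (cases "\<delta> = 0")
    case True
    then have "axis k \<delta> = 0" by (simp add: vec_eq_iff axis_def)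
    with \<theta>[OF that] show ?thesis by auto
  next
    case False
    have "0 < \<Gamma> t" if "\<delta>\<^sup>2 \<le> \<Gamma> t / (4 * real N)"
    proof -
      have "0 < \<Gamma> t / (4 * real N)"
        using that False by (intro less_le_trans[OF _ that]) simp
      with N show ?thesis by (simp add: zero_less_divide_iff)
    qed
    with \<theta>[OF that] show ?thesis by auto
  qed
  then have "chi2_le (marginal_law N T \<Gamma> \<pi> \<theta> N) (marginal_law N T \<Gamma> \<pi> \<theta>' N) (ennreal (exp (1 / (4 * real N))) ^ N)"
    using \<pi> by (intro chi2_le_marginal_law) auto
  \<comment> \<open>The randomised estimator is a common kernel, hence the extra factor 1.\<close>
  then have "chi2_le (?P \<theta>) (?P \<theta>') (ennreal (exp (1 / (4 * real N))) ^ N * 1)"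
    unfolding law using est_prob by (rule chi2_le_bind[OF _ sets sets measurable_prob_algebraD[OF est] measurable_prob_algebraD[OF est] chi2_le_refl])
  moreover have "ennreal (exp (1 / (4 * real N))) ^ N * 1 \<le> 2"
  proof -
    have "exp (1 / (4 * real N)) ^ N = exp (1 / 4)"
      using N by (simp flip: exp_of_nat_mult)
    moreover have "exp (1 / 4 :: real) \<le> 2"
      using exp_bound_half[of "1 / 4 :: real"] by simp
    ultimately show ?thesis
      by (simp add: ennreal_power flip: ennreal_numeral)
  qed
  ultimately have "chi2_le (?P \<theta>) (?P \<theta>') 2"
    by (rule chi2_le_mono)
  then have "ennreal ((norm (\<theta>' 0 - \<theta> 0))\<^sup>2 / 32) \<le> max (risk N T \<Gamma> alg \<theta>) (risk N T \<Gamma> alg \<theta>')"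
    unfolding risk_def by (intro two_point_bound P)
  also have "\<dots> \<le> (SUP \<theta>\<in>\<Psi>. risk N T \<Gamma> alg \<theta>)"
    using \<Psi> by (auto intro: SUP_upper)
  finally show "ennreal (\<delta>\<^sup>2 / 32) \<le> (SUP \<theta>\<in>\<Psi>. risk N T \<Gamma> alg \<theta>)"
    by (simp add: \<theta>0 norm_axis)
qed

section \<open>Pairs of instances inside the semi-local set\<close>

lemma semi_localI:
  assumes "\<zeta> permutes {1..T}" "\<And>t. t \<in> {1..T} \<Longrightarrow> (norm (\<theta> t - \<theta> 0))\<^sup>2 \<le> (q (\<zeta> t))\<^sup>2"
  shows "\<theta> \<in> semi_local T q"
  using assms by (auto simp: semi_local_def)

text \<open>
  Place the models \<open>1, \<dots>, m - 1\<close> at \<open>0\<close> and the models \<open>m, \<dots>, T\<close> at \<open>\<delta>\<close>: the target may lie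
  at either point, the second one being admissible through the order-reversing permutation,
  and only samples of the target itself tell the two instances apart.
\<close>

lemma minimax_risk_ge_target_shift:
  fixes q \<Gamma> :: "nat \<Rightarrow> real"
  assumes N: "1 \<le> N" and m: "1 \<le> m" "2 * m \<le> T + 2"
    and q: "\<And>t. m \<le> t \<Longrightarrow> t \<le> T \<Longrightarrow> \<delta>\<^sup>2 \<le> (q t)\<^sup>2" and \<delta>: "\<delta>\<^sup>2 \<le> \<Gamma> 0 / (4 * real N)"
  shows "ennreal (\<delta>\<^sup>2 / 32) \<le> minimax_risk N T (semi_local T q :: (nat \<Rightarrow> real ^ 'd::finite) set) \<Gamma>"
proof -
  fix k :: 'd
  define \<theta> :: "nat \<Rightarrow> real ^ 'd" where "\<theta> = (\<lambda>t. if t < m then 0 else axis k \<delta>)"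
  define \<theta>' where "\<theta>' = \<theta>(0 := axis k \<delta>)"
  have 0: "\<theta> 0 = 0" "\<theta>' 0 = axis k \<delta>" using m by (auto simp: \<theta>_def \<theta>'_def)
  show ?thesis
  proof (rule minimax_risk_two_point[where \<theta>=\<theta> and \<theta>'=\<theta>' and k=k, OF N])
    show "\<theta> \<in> semi_local T q"
      using q by (intro semi_localI[of id] permutes_id) (auto simp: 0 \<theta>_def norm_axis)
    define r where "r = (\<lambda>t. if t \<in> {1..T} then T + 1 - t else t)"
    have "r permutes {1..T}"
      by (rule bij_imp_permutes, rule bij_betw_byWitness[where f'=r]) (auto simp: r_def)
    \<comment> \<open>Now the models \<open>t < m\<close> are the distant ones. Reversal gives them
      radius index \<open>T + 1 - t\<close>, which is at least \<open>T + 2 - m\<close> and hence at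
      least \<open>m\<close> because \<open>2 * m \<le> T + 2\<close>.\<close>
    then show "\<theta>' \<in> semi_local T q"
      by (rule semi_localI) (use m in \<open>auto simp: 0 \<theta>_def \<theta>'_def norm_axis r_def intro!: q\<close>)
  qed (use \<delta> in \<open>auto simp: 0 \<theta>'_def\<close>)
qed

text \<open>When all means coincide and move together, every distance to the target stays 0, so the
  radii impose nothing. Every sample is informative, so each variance restricts
  \<open>\<delta>\<close>.\<close>

lemma minimax_risk_ge_common_shift:
  fixes q \<Gamma> :: "nat \<Rightarrow> real"
  assumes N: "1 \<le> N" and \<delta>: "\<And>t. t \<le> T \<Longrightarrow> \<delta>\<^sup>2 \<le> \<Gamma> t / (4 * real N)"
  shows "ennreal (\<delta>\<^sup>2 / 32) \<le> minimax_risk N T (semi_local T q :: (nat \<Rightarrow> real ^ 'd::finite) set) \<Gamma>"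
proof -
  fix k :: 'd
  have "(\<lambda>_. c) \<in> (semi_local T q :: (nat \<Rightarrow> real ^ 'd) set)" for c
    by (rule semi_localI[OF permutes_id]) simp
  then show ?thesis
    using \<delta> by (intro minimax_risk_two_point[where \<theta>="\<lambda>_. 0" and \<theta>'="\<lambda>_. axis k \<delta>" and k=k, OF N]) auto
qed

section \<open>The weak-oracle index and its median\<close>

lemma weak_oracle_mem:
  assumes "\<forall>t\<in>{1..T}. 0 \<le> q t" "mono_on {0..T} (\<lambda>t. (q t)\<^sup>2)" "antimono_on {0..T} \<Gamma>"
    and "weak_oracle N d T q \<Gamma> \<noteq> 0"
  shows "weak_oracle N d T q \<Gamma> \<in> weak_oracle_set N d T q \<Gamma>"
proof -
  have ne: "weak_oracle_set N d T q \<Gamma> \<noteq> {}"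
    using assms(4) by (auto simp: weak_oracle_def)
  moreover have "finite (weak_oracle_set N d T q \<Gamma>)"
    by (simp add: weak_oracle_set_def)
  ultimately show ?thesis
    using weak_oracle_eq_Max[OF assms(1-3) ne] by simp
qed

text \<open>By parity of \<open>t\<close>. This form reduces \<open>t_med t \<le> t\<close> for
  positive \<open>t\<close>, and \<open>2 * t_med t \<le> t + 2\<close>, to linear
  arithmetic.\<close>

lemma t_med_eq: "t_med t = t div 2 + 1"
proof -
  have "\<lceil>(real t + 1) / 2\<rceil> = int (t div 2 + 1)"
    by (rule ceiling_unique) (cases "even t"; auto elim!: evenE oddE)+
  then show ?thesis by (simp add: t_med_def)
qed

theorem theorem3:
  fixes N T :: nat and q \<Gamma> :: "nat \<Rightarrow> real"
  assumes "1 \<le> N" and "1 \<le> T"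
    and "q 0 = 0" and "\<forall>t\<in>{1..T}. 0 \<le> q t" and "mono_on {0..T} (\<lambda>t. (q t)\<^sup>2)"
    and "\<forall>t\<in>{0..T}. 0 \<le> \<Gamma> t" and "antimono_on {0..T} \<Gamma>"
  defines "d \<equiv> CARD('d::finite)"
  defines "t_wo \<equiv> weak_oracle N d T q \<Gamma>"
  shows "minimax_risk N T (semi_local T q :: (nat \<Rightarrow> real ^ 'd) set) \<Gamma>
    \<ge> ennreal (1 / 720 * (\<Gamma> T / real N +
        (if t_wo = 0 then \<kappa> d * (real d * \<Gamma> 0 / real N) else (q (t_med t_wo))\<^sup>2)))"
proof -
  let ?L = "minimax_risk N T (semi_local T q :: (nat \<Rightarrow> real ^ 'd) set) \<Gamma>"
  define s where "s = (if t_wo = 0 then \<kappa> d * (real d * \<Gamma> 0 / real N) else (q (t_med t_wo))\<^sup>2)"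
  \<comment> \<open>The dimension cancels, and the eligibility threshold is exactly the largest
    \<open>\<delta>\<^sup>2\<close> allowed when only the target moves.\<close>
  have threshold: "\<kappa> d * (real d * \<Gamma> 0 / real N) = \<Gamma> 0 / (4 * real N)"
    by (simp add: \<kappa>_def d_def)
  have \<Gamma>0: "0 \<le> \<Gamma> 0" and \<Gamma>T: "0 \<le> \<Gamma> T" using assms(6) by auto
  have s0: "0 \<le> s"
    using \<Gamma>0 unfolding s_def threshold by simp
  have mono: "(q i)\<^sup>2 \<le> (q j)\<^sup>2" if "i \<le> j" "j \<le> T" for i j
    using monotone_onD[OF assms(5), of i j] that by auto
  have "ennreal ((sqrt s)\<^sup>2 / 32) \<le> ?L"
  proof (cases "t_wo = 0")
    case True
    then have s_eq: "s = \<Gamma> 0 / (4 * real N)"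
      unfolding s_def threshold by simp
    \<comment> \<open>Eligible indices start at 1, so the value 0 can only be the default for an
      empty set. All radii then exceed the threshold \<open>s\<close>.\<close>
    have empty: "weak_oracle_set N d T q \<Gamma> = {}"
    proof (rule ccontr)
      assume ne: "weak_oracle_set N d T q \<Gamma> \<noteq> {}"
      have "finite (weak_oracle_set N d T q \<Gamma>)"
        by (simp add: weak_oracle_set_def)
      with ne weak_oracle_eq_Max[OF assms(4,5,7) ne] True have "0 \<in> weak_oracle_set N d T q \<Gamma>"
        by (metis Max_in t_wo_def)
      then show False by (simp add: weak_oracle_set_def)
    qed
    have "s \<le> (q t)\<^sup>2" if "1 \<le> t" "t \<le> T" for t
    proof (rule ccontr)
      assume "\<not> s \<le> (q t)\<^sup>2"
      with that True have "t \<in> weak_oracle_set N d T q \<Gamma>"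
        by (simp add: weak_oracle_set_def s_def)
      with empty show False by simp
    qed
    \<comment> \<open>With \<open>m = 1\<close> all models other than the target sit at
      \<open>sqrt s\<close>, and the target moves from 0 onto them.\<close>
    then show ?thesis
      using assms(1,2) s0 s_eq by (intro minimax_risk_ge_target_shift[where m=1]) auto
  next
    case False
    with weak_oracle_mem[OF assms(4,5,7)] have t_wo: "t_wo \<in> weak_oracle_set N d T q \<Gamma>"
      by (simp add: t_wo_def)
    then have le: "1 \<le> t_wo" "t_wo \<le> T" and q_wo: "(q t_wo)\<^sup>2 \<le> \<Gamma> 0 / (4 * real N)"
      unfolding weak_oracle_set_def threshold by auto
    have "t_med t_wo \<le> t_wo" and m: "1 \<le> t_med t_wo" "2 * t_med t_wo \<le> T + 2"
      using le by (auto simp: t_med_eq)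
    have s_eq: "s = (q (t_med t_wo))\<^sup>2" using False by (simp add: s_def)
    \<comment> \<open>The median index lies below the weak oracle, so by monotonicity of the radii
      it inherits eligibility.\<close>
    have "s \<le> \<Gamma> 0 / (4 * real N)"
      unfolding s_eq using mono[OF \<open>t_med t_wo \<le> t_wo\<close> le(2)] q_wo by (rule order_trans)
    with s0 mono show ?thesis
      by (intro minimax_risk_ge_target_shift[OF assms(1) m]) (auto simp: s_eq)
  qed
  \<comment> \<open>The smallest variance is the last one, so
    \<open>\<Gamma> T / (4 * real N)\<close> is an admissible squared shift for all models at
    once.\<close>
  moreover have "ennreal ((sqrt (\<Gamma> T / (4 * real N)))\<^sup>2 / 32) \<le> ?L"
    using \<Gamma>T monotone_onD[OF assms(7)]
    by (intro minimax_risk_ge_common_shift assms(1)) (auto intro!: divide_right_mono)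
  ultimately have L: "ennreal (s / 32) \<le> ?L" "ennreal (\<Gamma> T / (4 * real N) / 32) \<le> ?L"
    using s0 \<Gamma>T by simp_all
  \<comment> \<open>The sum is at most twice its larger term, so one of the two bounds suffices:
    \<open>2 / 720\<close> is below both \<open>1 / 32\<close> and \<open>1 / 128\<close>.\<close>
  have "1 / 720 * (\<Gamma> T / real N + s) \<le> s / 32 \<or> 1 / 720 * (\<Gamma> T / real N + s) \<le> \<Gamma> T / (4 * real N) / 32"
  proof -
    define r where "r = \<Gamma> T / real N"
    have e: "\<Gamma> T / (4 * real N) = r / 4" and "0 \<le> r" using \<Gamma>T by (simp_all add: r_def)
    with s0 show ?thesis unfolding r_def[symmetric] e by (cases "s \<le> r") (auto simp: field_simps)
  qed
  then show ?thesis
    unfolding s_def[symmetric]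
    using order_trans[OF ennreal_leI L(1)] order_trans[OF ennreal_leI L(2)] by blast
qed

end
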